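(* Let $\mathcal{E}$ be an $S_1\times\dots\times S_N$-setting family of $N$-partite joint measurements, $S_1+\dots+S_N>N$, with $\pm1$-valued outcomes at each site (all $\Lambda_n^{(s_n)}=\{-1,1\}$). Then $\mathcal{E}$ admits an LHV model if and only if there exist a probability space $(\Omega,\mathcal{F}_\Omega,\nu_{\mathcal{E}})$ and measurable functions $f_{n,s_n}:\Omega\to[-1,1]$, for all $n=1,\dots,N$ and $s_n=1,\dots,S_n$, such that for every $(s_1,\dots,s_N)$, every $1\le M\le N$ and all $1\le n_1<\dots<n_M\le N$, $$\Big\langle \lambda_{n_1}^{(s_{n_1})}\cdots\lambda_{n_M}^{(s_{n_M})}\Big\rangle_{\mathcal{E}}=\int_\Omega f_{n_1,s_{n_1}}(\omega)\cdots f_{n_M,s_{n_M}}(\omega)\,\nu_{\mathcal{E}}(d\omega),$$ where the left-hand side is the expectation, with respect to the joint distribution $P^{(\mathcal{E})}_{(s_1,\dots,s_N)}$, of the product of the outcomes at sites $n_1,\dots,n_M$.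
   Context: An $S_1\times\dots\times S_N$-setting family $\mathcal{E}$ of $N$-partite joint measurements consists of positive integers $N,S_1,\dots,S_N$, an outcome space $\Lambda_n^{(s_n)}$ for each site $n\in\{1,\dots,N\}$ and setting $s_n\in\{1,\dots,S_n\}$, and, for each $(s_1,\dots,s_N)$ with $s_n\in\{1,\dots,S_n\}$, a probability measure $P^{(\mathcal{E})}_{(s_1,\dots,s_N)}$ on $\Lambda_1^{(s_1)}\times\dots\times\Lambda_N^{(s_N)}$; $\lambda_n^{(s_n)}$ denotes the outcome at site $n$. LHV model: the family $\mathcal{E}$ (with $S_1+\dots+S_N>N$) admits a local hidden variable (LHV) model if there exist a single probability space $(\Omega,\mathcal{F}_\Omega,\nu_{\mathcal{E}})$ and, for each $n$ and $s_n$, a conditional probability distribution $P_n^{(s_n)}(\cdot|\omega)$ on $\Lambda_n^{(s_n)}$, defined for $\nu_{\mathcal{E}}$-almost every $\omega$, with $\omega\mapsto P_n^{(s_n)}(D|\omega)$ measurable for each $D$, and depending only on the setting $s_n$ at site $n$, such that for all $(s_1,\dots,s_N)$ and all $D_n\subseteq\Lambda_n^{(s_n)}$, $$P^{(\mathcal{E})}_{(s_1,\dots,s_N)}(D_1\times\dots\times D_N)=\int_\Omega P_1^{(s_1)}(D_1|\omega)\cdots P_N^{(s_N)}(D_N|\omega)\,\nu_{\mathcal{E}}(d\omega).$$ *)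

theory Defs
  imports "HOL-Probability.Probability"
begin

definition setting_tuples :: "nat \<Rightarrow> (nat \<Rightarrow> nat) \<Rightarrow> (nat \<Rightarrow> nat) set" where
  "setting_tuples N S = (\<Pi>\<^sub>E n\<in>{1..N}. {1..S n})"

(* The measures \<Lambda> n k only serve as measurable spaces: emeasure (\<Lambda> n k) plays no role. *)
definition measurement_family ::
  "nat \<Rightarrow> (nat \<Rightarrow> nat) \<Rightarrow> (nat \<Rightarrow> nat \<Rightarrow> 'a measure) \<Rightarrow> ((nat \<Rightarrow> nat) \<Rightarrow> (nat \<Rightarrow> 'a) measure) \<Rightarrow> bool"
  where
  "measurement_family N S \<Lambda> P \<longleftrightarrow>
     N \<ge> 1 \<and> (\<forall>n\<in>{1..N}. S n \<ge> 1) \<and>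
     (\<forall>s\<in>setting_tuples N S.
        prob_space (P s) \<and> sets (P s) = sets (\<Pi>\<^sub>M n\<in>{1..N}. \<Lambda> n (s n)))"

(* A conditional distribution that is defined only almost everywhere is represented by a total
   function whose values off a null set are unconstrained.  Extending by the null measure keeps
   D-wise measurability, so this loses no generality. *)
definition conditional_distribution ::
  "'w measure \<Rightarrow> 'a measure \<Rightarrow> ('w \<Rightarrow> 'a measure) \<Rightarrow> bool" where
  "conditional_distribution \<nu> L K \<longleftrightarrow>
     (AE \<omega> in \<nu>. prob_space (K \<omega>) \<and> sets (K \<omega>) = sets L) \<and>
     (\<forall>D\<in>sets L. (\<lambda>\<omega>. measure (K \<omega>) D) \<in> borel_measurable \<nu>)"

definition LHV_model ::
  "nat \<Rightarrow> (nat \<Rightarrow> nat) \<Rightarrow> (nat \<Rightarrow> nat \<Rightarrow> 'a measure) \<Rightarrow> ((nat \<Rightarrow> nat) \<Rightarrow> (nat \<Rightarrow> 'a) measure)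
     \<Rightarrow> 'w measure \<Rightarrow> (nat \<Rightarrow> nat \<Rightarrow> 'w \<Rightarrow> 'a measure) \<Rightarrow> bool"
  where
  "LHV_model N S \<Lambda> P \<nu> K \<longleftrightarrow>
     prob_space \<nu> \<and>
     (\<forall>n\<in>{1..N}. \<forall>k\<in>{1..S n}. conditional_distribution \<nu> (\<Lambda> n k) (K n k)) \<and>
     (\<forall>s\<in>setting_tuples N S. \<forall>D\<in>(\<Pi> n\<in>{1..N}. sets (\<Lambda> n (s n))).
        measure (P s) (\<Pi>\<^sub>E n\<in>{1..N}. D n) =
          (\<integral>\<omega>. (\<Prod>n=1..N. measure (K n (s n) \<omega>) (D n)) \<partial>\<nu>))"

(* HOL cannot quantify over the type carrying the hidden variable, so it is a parameter. *)
definition admits_LHV_model ::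
  "'w itself \<Rightarrow> nat \<Rightarrow> (nat \<Rightarrow> nat) \<Rightarrow> (nat \<Rightarrow> nat \<Rightarrow> 'a measure)
     \<Rightarrow> ((nat \<Rightarrow> nat) \<Rightarrow> (nat \<Rightarrow> 'a) measure) \<Rightarrow> bool"
  where
  "admits_LHV_model (_ :: 'w itself) N S \<Lambda> P \<longleftrightarrow>
     (\<exists>(\<nu> :: 'w measure) K. LHV_model N S \<Lambda> P \<nu> K)"

end

theory Submission
  imports Defs
begin

text \<open>Every function on \<open>{-1, 1}\<close> is affine, so a \<open>\<plusminus>1\<close>-valued conditional distribution is
  determined by its mean \<open>f \<in> [-1, 1]\<close>, and conversely.  Expanding a product of affine functions
  over subsets turns agreement of the correlation functions of all orders into agreement of the
  probabilities of all product events, and back; the hidden variable space does not change.\<close>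

section \<open>Mixed moments and products of affine functions\<close>

text \<open>A finite product of factors bounded by 1 is bounded by 1, hence integrable for a finite
  measure. The bounds are only asked for almost everywhere because a conditional distribution may
  fail to be a probability measure on a null set.\<close>

lemma integrable_prod_AE_bounded:
  fixes u :: "'i \<Rightarrow> 'a \<Rightarrow> real"
  assumes "finite_measure M" "finite J"
    and meas: "\<And>n. n \<in> J \<Longrightarrow> u n \<in> borel_measurable M"
    and bound: "\<And>n. n \<in> J \<Longrightarrow> AE x in M. \<bar>u n x\<bar> \<le> 1"
  shows "integrable M (\<lambda>x. \<Prod>n\<in>J. u n x)"
proof -
  interpret finite_measure M by fact
  have "AE x in M. \<forall>n\<in>J. \<bar>u n x\<bar> \<le> 1"
    using bound \<open>finite J\<close> by (simp add: AE_finite_all)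
  then have "AE x in M. norm (\<Prod>n\<in>J. u n x) \<le> 1"
    by eventually_elim (simp add: abs_prod prod_le_1)
  then show ?thesis
    using meas by (intro integrable_const_bound[where B = 1]) auto
qed

text \<open>Expanding the product means choosing one summand from each factor; \<open>J\<close> is
  the set of indices at which the term with \<open>u n\<close> is chosen.\<close>

lemma prod_affine_eq_sum_Pow:
  fixes a b u :: "'i \<Rightarrow> real"
  assumes "finite I"
  shows "(\<Prod>n\<in>I. a n + b n * u n)
    = (\<Sum>J\<in>Pow I. ((\<Prod>n\<in>I - J. a n) * (\<Prod>n\<in>J. b n)) * (\<Prod>n\<in>J. u n))"
proof -
  have "(\<Prod>n\<in>I. a n + b n * u n) = (\<Prod>n\<in>I. b n * u n + a n)"
    by (simp add: add.commute)
  also have "\<dots> = (\<Sum>J\<in>Pow I. (\<Prod>n\<in>J. b n * u n) * (\<Prod>n\<in>I - J. a n))"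
    using assms by (rule prod_add)
  finally show ?thesis
    by (simp add: prod.distrib mult_ac)
qed

text \<open>By the subset expansion both integrals are the same linear combination of mixed moments,
  so equal moments suffice. The case \<open>J = {}\<close> belongs to the assumption: there the
  moments are the total masses.\<close>

lemma integral_prod_affine_cong:
  fixes u :: "'i \<Rightarrow> 'a \<Rightarrow> real" and v :: "'i \<Rightarrow> 'b \<Rightarrow> real"
  assumes "finite I"
    and u: "\<And>J. J \<subseteq> I \<Longrightarrow> integrable \<mu> (\<lambda>x. \<Prod>n\<in>J. u n x)"
    and v: "\<And>J. J \<subseteq> I \<Longrightarrow> integrable \<nu> (\<lambda>y. \<Prod>n\<in>J. v n y)"
    and eq: "\<And>J. J \<subseteq> I \<Longrightarrow> (\<integral>x. (\<Prod>n\<in>J. u n x) \<partial>\<mu>) = (\<integral>y. (\<Prod>n\<in>J. v n y) \<partial>\<nu>)"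
  shows "(\<integral>x. (\<Prod>n\<in>I. a n + b n * u n x) \<partial>\<mu>) = (\<integral>y. (\<Prod>n\<in>I. a n + b n * v n y) \<partial>\<nu>)"
proof -
  have "(\<integral>x. (\<Prod>n\<in>I. a n + b n * u n x) \<partial>\<mu>)
    = (\<Sum>J\<in>Pow I. ((\<Prod>n\<in>I - J. a n) * (\<Prod>n\<in>J. b n)) * (\<integral>x. (\<Prod>n\<in>J. u n x) \<partial>\<mu>))"
    unfolding prod_affine_eq_sum_Pow[OF \<open>finite I\<close>]
    by (subst Bochner_Integration.integral_sum) (auto intro!: u)
  also have "\<dots>
    = (\<Sum>J\<in>Pow I. ((\<Prod>n\<in>I - J. a n) * (\<Prod>n\<in>J. b n)) * (\<integral>y. (\<Prod>n\<in>J. v n y) \<partial>\<nu>))"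
    by (intro sum.cong refl) (simp add: eq)
  also have "\<dots> = (\<integral>y. (\<Prod>n\<in>I. a n + b n * v n y) \<partial>\<nu>)"
    unfolding prod_affine_eq_sum_Pow[OF \<open>finite I\<close>]
    by (subst Bochner_Integration.integral_sum) (auto intro!: v)
  finally show ?thesis .
qed

section \<open>Product events and index sets of correlations\<close>

text \<open>The indicator of a box is the product of the indicators of its sides at extensional
  points, and all points of \<open>space M\<close> are extensional because \<open>M\<close> carries
  the product sigma-algebra.\<close>

lemma measure_PiE_eq_integral_prod_indicator:
  assumes M: "sets M = sets (\<Pi>\<^sub>M n\<in>I. L n)" and "finite I"
    and D: "\<And>n. n \<in> I \<Longrightarrow> D n \<in> sets (L n)"
  shows "measure M (\<Pi>\<^sub>E n\<in>I. D n) = (\<integral>x. (\<Prod>n\<in>I. indicator (D n) (x n)) \<partial>M)"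
proof -
  have space: "space M = (\<Pi>\<^sub>E n\<in>I. space (L n))"
    using sets_eq_imp_space_eq[OF M] by (simp add: space_PiM)
  have "(\<Pi>\<^sub>E n\<in>I. D n) \<subseteq> space M"
    unfolding space using D by (intro PiE_mono) (auto dest: sets.sets_into_space)
  then have "measure M (\<Pi>\<^sub>E n\<in>I. D n) = (\<integral>x. indicator (\<Pi>\<^sub>E n\<in>I. D n) x \<partial>M)"
    by (simp add: Int_absorb2)
  also have "\<dots> = (\<integral>x. (\<Prod>n\<in>I. indicator (D n) (x n)) \<partial>M)"
  proof (rule Bochner_Integration.integral_cong[OF refl])
    fix x assume "x \<in> space M"
    then have "x \<in> extensional I" by (simp add: space PiE_def)
    show "indicator (\<Pi>\<^sub>E n\<in>I. D n) x = (\<Prod>n\<in>I. indicator (D n) (x n) :: real)"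
    proof (cases "x \<in> (\<Pi>\<^sub>E n\<in>I. D n)")
      case True
      then show ?thesis by (auto simp: PiE_iff indicator_def)
    next
      case False
      with \<open>x \<in> extensional I\<close> obtain n where "n \<in> I" "x n \<notin> D n"
        by (auto simp: PiE_iff)
      with \<open>finite I\<close> have "(\<Prod>n\<in>I. indicator (D n) (x n) :: real) = 0"
        by (intro prod_zero bexI[of _ n]) auto
      with False show ?thesis by simp
    qed
  qed
  finally show ?thesis .
qed

text \<open>A strictly increasing \<open>n\<close> enumerates its image, a nonempty set of sites,
  and every nonempty set of sites arises in this way; reindexing along the enumeration identifies
  the products. The subset form is the one that the affine expansion works with.\<close>

lemma all_strict_mono_prod_iff:
  fixes N :: nat
  shows "(\<forall>M\<in>{1..N}. \<forall>n\<in>{1..M} \<rightarrow> {1..N}. strict_mono_on {1..M} n \<longrightarrow>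
      (\<integral>x. (\<Prod>i=1..M. u (n i) x) \<partial>\<mu>) = (\<integral>y. (\<Prod>i=1..M. v (n i) y :: real) \<partial>\<nu>))
    \<longleftrightarrow> (\<forall>J. J \<subseteq> {1..N} \<longrightarrow> J \<noteq> {} \<longrightarrow>
      (\<integral>x. (\<Prod>j\<in>J. u j x) \<partial>\<mu>) = (\<integral>y. (\<Prod>j\<in>J. v j y :: real) \<partial>\<nu>))"
    (is "?L \<longleftrightarrow> ?R")
proof
  assume L: ?L
  show ?R
  proof (intro allI impI)
    fix J assume J: "J \<subseteq> {1..N}" "J \<noteq> {}"
    then have "finite J" by (auto intro: finite_subset)
    obtain h where h: "bij_betw h {..<card J} J" "strict_mono_on {..<card J} h"
      using ex_bij_betw_strict_mono_card[OF \<open>finite J\<close>] by blast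
    \<comment> \<open>\<open>h\<close> counts from 0, whereas correlations are indexed from 1.
      Truncated subtraction does no harm, since only indices in \<open>{1..card J}\<close>
      matter.\<close>
    define n where "n i = h (i - 1)" for i
    have "bij_betw (\<lambda>i::nat. i - 1) {1..card J} {..<card J}"
      by (rule bij_betw_byWitness[where f' = Suc]) auto
    from bij_betw_trans[OF this h(1)] have bij: "bij_betw n {1..card J} J"
      by (simp add: comp_def n_def[abs_def])
    have "strict_mono_on {1..card J} n"
    proof (rule strict_mono_onI)
      fix r s :: nat assume "r \<in> {1..card J}" "s \<in> {1..card J}" "r < s"
      then show "n r < n s"
        unfolding n_def by (intro strict_mono_onD[OF h(2)]) auto
    qed
    moreover have "n \<in> {1..card J} \<rightarrow> {1..N}"
      using bij J by (auto simp: bij_betw_def)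
    moreover have "card J \<in> {1..N}"
      using J \<open>finite J\<close> card_mono[OF _ J(1)] by (simp add: Suc_le_eq card_gt_0_iff)
    ultimately have "(\<integral>x. (\<Prod>i=1..card J. u (n i) x) \<partial>\<mu>) = (\<integral>y. (\<Prod>i=1..card J. v (n i) y) \<partial>\<nu>)"
      using L by blast
    then show "(\<integral>x. (\<Prod>j\<in>J. u j x) \<partial>\<mu>) = (\<integral>y. (\<Prod>j\<in>J. v j y) \<partial>\<nu>)"
      by (simp add: prod.reindex_bij_betw[OF bij, symmetric])
  qed
next
  assume R: ?R
  show ?L
  proof (intro ballI impI)
    fix M n assume M: "M \<in> {1..N}" and n: "n \<in> {1..M} \<rightarrow> {1..N}" "strict_mono_on {1..M} n"
    have "bij_betw n {1..M} (n ` {1..M})"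
      using strict_mono_on_imp_inj_on[OF n(2)] by (simp add: bij_betw_def)
    note reindex = prod.reindex_bij_betw[OF this]
    have "n ` {1..M} \<subseteq> {1..N}" "n ` {1..M} \<noteq> {}"
      using n M by auto
    with R have "(\<integral>x. (\<Prod>j\<in>n ` {1..M}. u j x) \<partial>\<mu>) = (\<integral>y. (\<Prod>j\<in>n ` {1..M}. v j y) \<partial>\<nu>)"
      by blast
    then show "(\<integral>x. (\<Prod>i=1..M. u (n i) x) \<partial>\<mu>) = (\<integral>y. (\<Prod>i=1..M. v (n i) y) \<partial>\<nu>)"
      unfolding reindex[symmetric] .
  qed
qed

section \<open>Two-point laws with prescribed mean\<close>

text \<open>For \<open>m\<close> in \<open>[-1, 1]\<close> this is the unique probability law on
  \<open>{-1, 1}\<close> with mean \<open>m\<close>. For other \<open>m\<close>,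
  \<open>ennreal\<close> cuts the negative weight to 0 and the total mass exceeds 1.\<close>

definition sign_measure :: "real \<Rightarrow> real measure" where
  "sign_measure m = point_measure {-1, 1} (\<lambda>v. ennreal ((1 + v * m) / 2))"

lemma sets_sign_measure: "sets (sign_measure m) = Pow {-1, 1}"
  by (simp add: sign_measure_def sets_point_measure)

lemma measure_sign_measure:
  assumes "m \<in> {-1..1}" "D \<subseteq> {-1, 1}"
  shows "measure (sign_measure m) D = (\<Sum>v\<in>D. (1 + v * m) / 2)"
proof -
  \<comment> \<open>The range of \<open>m\<close> enters here: with nonnegative weights
    \<open>ennreal\<close> truncates nothing and commutes with the sum.\<close>
  have nonneg: "(1 + v * m) / 2 \<ge> 0" if "v \<in> D" for v
    using that assms by auto
  have "emeasure (sign_measure m) D = (\<Sum>v\<in>D. ennreal ((1 + v * m) / 2))"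
    unfolding sign_measure_def using assms by (intro emeasure_point_measure_finite) auto
  also have "\<dots> = ennreal (\<Sum>v\<in>D. (1 + v * m) / 2)"
    using nonneg by (rule sum_ennreal)
  finally show ?thesis
    using nonneg by (simp add: measure_def sum_nonneg del: sum_divide_distrib)
qed

lemma prob_space_sign_measure:
  assumes "m \<in> {-1..1}"
  shows "prob_space (sign_measure m)"
proof
  have "emeasure (sign_measure m) {-1, 1} = 1"
    unfolding sign_measure_def using assms
    by (subst emeasure_point_measure_finite) (simp_all flip: ennreal_plus add: field_simps)
  then show "emeasure (sign_measure m) (space (sign_measure m)) = 1"
    by (simp add: sign_measure_def space_point_measure)
qed

text \<open>Together with \<open>event_slope\<close>, the coefficients of the line that interpolates
  the indicator of \<open>D\<close> at the two points -1 and 1.\<close>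

definition event_offset :: "real set \<Rightarrow> real" where
  "event_offset D = (indicator D 1 + indicator D (-1)) / 2"

definition event_slope :: "real set \<Rightarrow> real" where
  "event_slope D = (indicator D 1 - indicator D (-1)) / 2"

lemma indicator_affine:
  assumes "v \<in> {-1, 1 :: real}"
  shows "indicator D v = event_offset D + event_slope D * v"
  using assms by (auto simp: event_offset_def event_slope_def field_simps)

text \<open>This is the expectation of the affine form of the indicator under a law with mean
  \<open>m\<close>; the proof simply checks the four subsets of \<open>{-1, 1}\<close>.\<close>

lemma measure_sign_measure_affine:
  assumes "m \<in> {-1..1}" "D \<subseteq> {-1, 1}"
  shows "measure (sign_measure m) D = event_offset D + event_slope D * m"
proof -
  have "D = {} \<or> D = {-1} \<or> D = {1} \<or> D = {-1, 1}"
    using assms(2) by blast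
  then show ?thesis
    using measure_sign_measure[OF assms]
    by (auto simp: event_offset_def event_slope_def field_simps)
qed

section \<open>Outcome space and measurability for sign-valued sites\<close>

context
  fixes M :: "(nat \<Rightarrow> real) measure" and I :: "nat set" and L :: "nat \<Rightarrow> real measure"
  assumes sets_M: "sets M = sets (\<Pi>\<^sub>M n\<in>I. L n)"
    and L: "\<And>n. n \<in> I \<Longrightarrow> sets (L n) = sets (count_space {-1, 1})"
begin

lemma space_sign_outcomes: "space M = (\<Pi>\<^sub>E n\<in>I. {-1, 1})"
proof -
  have "space M = (\<Pi>\<^sub>E n\<in>I. space (L n))"
    using sets_eq_imp_space_eq[OF sets_M] by (simp add: space_PiM)
  also have "\<dots> = (\<Pi>\<^sub>E n\<in>I. {-1, 1})"
    by (intro PiE_cong) (simp add: sets_eq_imp_space_eq[OF L])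
  finally show ?thesis .
qed

lemma sign_outcome_cases:
  assumes "x \<in> space M" "n \<in> I"
  shows "x n \<in> {-1, 1}"
  using assms unfolding space_sign_outcomes by (rule PiE_mem)

text \<open>The sigma-algebra at each site is discrete, so an arbitrary \<open>h\<close> is
  measurable there and can be composed with the coordinate projection.\<close>

lemma borel_measurable_sign_outcome:
  assumes "n \<in> I"
  shows "(\<lambda>x. h (x n) :: real) \<in> borel_measurable M"
proof (rule measurable_compose[where N = "L n" and f = "\<lambda>x. x n" and g = h])
  show "(\<lambda>x. x n) \<in> M \<rightarrow>\<^sub>M L n"
    using measurable_component_singleton[OF assms, of L]
    by (simp add: measurable_cong_sets[OF sets_M refl])
  show "h \<in> borel_measurable (L n)"
    by (simp add: measurable_cong_sets[OF L[OF assms] refl])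
qed

end

section \<open>From a hidden variable model to correlations\<close>

text \<open>The truncation at 1 only acts on the null set where \<open>K\<close> may fail to be a probability measure.\<close>

lemma LHV_model_imp_correlations:
  fixes \<Lambda> :: "nat \<Rightarrow> nat \<Rightarrow> real measure"
  assumes family: "measurement_family N S \<Lambda> P"
    and \<Lambda>: "\<And>n k. n \<in> {1..N} \<Longrightarrow> k \<in> {1..S n} \<Longrightarrow> sets (\<Lambda> n k) = sets (count_space {-1, 1})"
    and model: "LHV_model N S \<Lambda> P \<nu> K"
    and s: "s \<in> setting_tuples N S" and J: "J \<subseteq> {1..N}"
  shows "(\<integral>x. (\<Prod>n\<in>J. x n) \<partial>P s) = (\<integral>\<omega>. (\<Prod>n\<in>J. min 1 (2 * measure (K n (s n) \<omega>) {1} - 1)) \<partial>\<nu>)"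
proof -
  have s_range: "s n \<in> {1..S n}" if "n \<in> {1..N}" for n
    using s that by (auto simp: setting_tuples_def)
  have \<Lambda>s: "sets (\<Lambda> n (s n)) = sets (count_space {-1, 1})" if "n \<in> {1..N}" for n
    using \<Lambda>[OF that s_range[OF that]] .
  from family s have "prob_space (P s)" and sets_P: "sets (P s) = sets (\<Pi>\<^sub>M n\<in>{1..N}. \<Lambda> n (s n))"
    by (auto simp: measurement_family_def)
  interpret P: prob_space "P s" by fact
  interpret \<nu>: prob_space \<nu> using model by (simp add: LHV_model_def)
  have cond: "conditional_distribution \<nu> (\<Lambda> n (s n)) (K n (s n))" if "n \<in> {1..N}" for n
    using model that s_range by (simp add: LHV_model_def)
  let ?p = "\<lambda>n \<omega>. measure (K n (s n) \<omega>) {1}"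
  \<comment> \<open>There are finitely many sites, so the exceptional null sets of their conditional
    distributions merge into one.\<close>
  have "AE \<omega> in \<nu>. \<forall>n\<in>{1..N}. prob_space (K n (s n) \<omega>) \<and> sets (K n (s n) \<omega>) = sets (\<Lambda> n (s n))"
    using cond by (subst AE_finite_all) (auto simp: conditional_distribution_def)
  then have AE_K: "AE \<omega> in \<nu>. \<forall>n\<in>{1..N}. measure (K n (s n) \<omega>) {-1, 1} = 1 \<and> ?p n \<omega> \<le> 1"
  proof eventually_elim
    case (elim \<omega>)
    show ?case
    proof
      fix n assume n: "n \<in> {1..N}"
      with elim interpret prob_space "K n (s n) \<omega>" by blast
      have "space (K n (s n) \<omega>) = {-1, 1}"
        using elim n \<Lambda>s[OF n] sets_eq_imp_space_eq[of "K n (s n) \<omega>" "count_space {-1, 1}"] n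
        by simp
      then show "measure (K n (s n) \<omega>) {-1, 1} = 1 \<and> ?p n \<omega> \<le> 1"
        using prob_space prob_le_1 by metis
    qed
  qed
  have p_meas: "?p n \<in> borel_measurable \<nu>" if "n \<in> {1..N}" for n
    using cond[OF that] \<Lambda>s[OF that] by (simp add: conditional_distribution_def)
  have moments: "(\<integral>x. (\<Prod>n\<in>A. indicator {1} (x n)) \<partial>P s) = (\<integral>\<omega>. (\<Prod>n\<in>A. ?p n \<omega>) \<partial>\<nu>)"
    if A: "A \<subseteq> {1..N}" for A
  proof -
    \<comment> \<open>The event \<open>{1}\<close> is tested at the sites in \<open>A\<close> and
      the sure event at all others. The latter contribute factors 1, exactly for the outcomes and
      almost everywhere for the model, so the product formula over all sites yields the moment over
      \<open>A\<close> alone.\<close>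
    define D where "D n = (if n \<in> A then {1} else {-1, 1 :: real})" for n
    have D: "D n \<in> sets (\<Lambda> n (s n))" if "n \<in> {1..N}" for n
      using \<Lambda>s[OF that] by (simp add: D_def)
    have split: "(\<Prod>n\<in>{1..N}. if n \<in> A then g n else 1) = (\<Prod>n\<in>A. g n)" for g :: "nat \<Rightarrow> real"
      using A by (simp add: prod.If_cases Int_absorb1)
    have "(\<integral>x. (\<Prod>n\<in>A. indicator {1} (x n)) \<partial>P s)
      = (\<integral>x. (\<Prod>n\<in>{1..N}. indicator (D n) (x n) :: real) \<partial>P s)"
    proof (rule Bochner_Integration.integral_cong[OF refl])
      fix x assume "x \<in> space (P s)"
      note x_range = sign_outcome_cases[OF sets_P \<Lambda>s this]
      have "(\<Prod>n\<in>{1..N}. indicator (D n) (x n) :: real)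
        = (\<Prod>n\<in>{1..N}. if n \<in> A then indicator {1} (x n) else 1)"
        using x_range by (intro prod.cong) (auto simp: D_def)
      then show "(\<Prod>n\<in>A. indicator {1} (x n)) = (\<Prod>n\<in>{1..N}. indicator (D n) (x n) :: real)"
        by (simp only: split)
    qed
    also have "\<dots> = measure (P s) (\<Pi>\<^sub>E n\<in>{1..N}. D n)"
      using D by (intro measure_PiE_eq_integral_prod_indicator[OF sets_P, symmetric]
          finite_atLeastAtMost)
    also have "\<dots> = (\<integral>\<omega>. (\<Prod>n=1..N. measure (K n (s n) \<omega>) (D n)) \<partial>\<nu>)"
      using model s D by (auto simp: LHV_model_def)
    also have "\<dots> = (\<integral>\<omega>. (\<Prod>n\<in>A. ?p n \<omega>) \<partial>\<nu>)"
    proof (rule integral_cong_AE)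
      show "(\<lambda>\<omega>. \<Prod>n=1..N. measure (K n (s n) \<omega>) (D n)) \<in> borel_measurable \<nu>"
        using cond D by (intro borel_measurable_prod) (auto simp: conditional_distribution_def)
      show "(\<lambda>\<omega>. \<Prod>n\<in>A. ?p n \<omega>) \<in> borel_measurable \<nu>"
        using p_meas A by (intro borel_measurable_prod) auto
      show "AE \<omega> in \<nu>. (\<Prod>n=1..N. measure (K n (s n) \<omega>) (D n)) = (\<Prod>n\<in>A. ?p n \<omega>)"
        using AE_K
      proof eventually_elim
        case (elim \<omega>)
        then have "(\<Prod>n=1..N. measure (K n (s n) \<omega>) (D n)) = (\<Prod>n\<in>{1..N}. if n \<in> A then ?p n \<omega> else 1)"
          by (intro prod.cong) (auto simp: D_def)
        then show ?case by (simp only: split)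
      qed
    qed
    finally show ?thesis .
  qed
  \<comment> \<open>An outcome in \<open>{-1, 1}\<close> equals -1 plus twice the indicator of
    \<open>{1}\<close>; this makes it affine in the variables whose moments \<open>moments\<close>
    has matched.\<close>
  have "(\<integral>x. (\<Prod>n\<in>J. x n) \<partial>P s) = (\<integral>x. (\<Prod>n\<in>J. -1 + 2 * indicator {1} (x n)) \<partial>P s)"
  proof (rule Bochner_Integration.integral_cong[OF refl])
    fix x assume "x \<in> space (P s)"
    note x_range = sign_outcome_cases[OF sets_P \<Lambda>s this]
    from J x_range show "(\<Prod>n\<in>J. x n) = (\<Prod>n\<in>J. -1 + 2 * indicator {1} (x n))"
      by (intro prod.cong) (force simp: indicator_def)+
  qed
  also have "\<dots> = (\<integral>\<omega>. (\<Prod>n\<in>J. -1 + 2 * ?p n \<omega>) \<partial>\<nu>)"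
  proof (rule integral_prod_affine_cong)
    show "finite J" using J by (rule finite_subset) simp
    fix A assume "A \<subseteq> J"
    with J have A: "A \<subseteq> {1..N}" and "finite A" by (auto intro: finite_subset)
    show "integrable (P s) (\<lambda>x. \<Prod>n\<in>A. indicator {1} (x n) :: real)"
      using A \<open>finite A\<close> by (intro integrable_prod_AE_bounded P.finite_measure_axioms)
        (auto intro!: borel_measurable_sign_outcome[OF sets_P \<Lambda>s] simp: indicator_def)
    have "AE \<omega> in \<nu>. \<bar>?p n \<omega>\<bar> \<le> 1" if "n \<in> A" for n
      using AE_K by eventually_elim (use that A in auto)
    then show "integrable \<nu> (\<lambda>\<omega>. \<Prod>n\<in>A. ?p n \<omega>)"
      using A \<open>finite A\<close> by (intro integrable_prod_AE_bounded \<nu>.finite_measure_axioms)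
        (auto intro!: p_meas)
    show "(\<integral>x. (\<Prod>n\<in>A. indicator {1} (x n)) \<partial>P s) = (\<integral>\<omega>. (\<Prod>n\<in>A. ?p n \<omega>) \<partial>\<nu>)"
      by (rule moments[OF A])
  qed
  \<comment> \<open>Almost everywhere \<open>?p n \<omega>\<close> is at most 1, and there the
    minimum changes nothing.\<close>
  also have "\<dots> = (\<integral>\<omega>. (\<Prod>n\<in>J. min 1 (2 * ?p n \<omega> - 1)) \<partial>\<nu>)"
  proof (rule integral_cong_AE)
    show "(\<lambda>\<omega>. \<Prod>n\<in>J. -1 + 2 * ?p n \<omega>) \<in> borel_measurable \<nu>"
      using p_meas J by (intro borel_measurable_prod borel_measurable_add borel_measurable_times) auto
    show "(\<lambda>\<omega>. \<Prod>n\<in>J. min 1 (2 * ?p n \<omega> - 1)) \<in> borel_measurable \<nu>"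
      using p_meas J by (intro borel_measurable_prod borel_measurable_min borel_measurable_diff
          borel_measurable_times) auto
    show "AE \<omega> in \<nu>. (\<Prod>n\<in>J. -1 + 2 * ?p n \<omega>) = (\<Prod>n\<in>J. min 1 (2 * ?p n \<omega> - 1))"
      using AE_K by eventually_elim (use J in \<open>intro prod.cong; force simp: min_def\<close>)
  qed
  finally show ?thesis .
qed

section \<open>From correlations to a hidden variable model\<close>

text \<open>Given \<omega>, the sites respond independently with means
  \<open>f n k \<omega>\<close>. The conditional probability of an event is affine in this mean with
  the same coefficients as its indicator in the outcome, so matching correlations force matching box
  probabilities.\<close>

lemma correlations_imp_LHV_model:
  fixes \<Lambda> :: "nat \<Rightarrow> nat \<Rightarrow> real measure"
  assumes family: "measurement_family N S \<Lambda> P"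
    and \<Lambda>: "\<And>n k. n \<in> {1..N} \<Longrightarrow> k \<in> {1..S n} \<Longrightarrow> sets (\<Lambda> n k) = sets (count_space {-1, 1})"
    and "prob_space \<nu>"
    and f: "\<And>n k. n \<in> {1..N} \<Longrightarrow> k \<in> {1..S n} \<Longrightarrow> f n k \<in> \<nu> \<rightarrow>\<^sub>M restrict_space borel {-1..1}"
    and corr: "\<And>s J. s \<in> setting_tuples N S \<Longrightarrow> J \<subseteq> {1..N} \<Longrightarrow> J \<noteq> {} \<Longrightarrow>
      (\<integral>x. (\<Prod>n\<in>J. x n) \<partial>P s) = (\<integral>\<omega>. (\<Prod>n\<in>J. f n (s n) \<omega>) \<partial>\<nu>)"
  shows "LHV_model N S \<Lambda> P \<nu> (\<lambda>n k \<omega>. sign_measure (f n k \<omega>))"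
  unfolding LHV_model_def
proof (intro conjI ballI)
  interpret \<nu>: prob_space \<nu> by fact
  show "prob_space \<nu>" by fact
  have f_meas: "f n k \<in> borel_measurable \<nu>" if "n \<in> {1..N}" "k \<in> {1..S n}" for n k
    using f[OF that] by (rule measurable_restrict_space2_iff[THEN iffD1, THEN conjunct1])
  have f_range: "f n k \<omega> \<in> {-1..1}" if "n \<in> {1..N}" "k \<in> {1..S n}" "\<omega> \<in> space \<nu>" for n k \<omega>
    using measurable_space[OF f[OF that(1,2)] that(3)] by (simp add: space_restrict_space)
  {
    fix n k assume nk: "n \<in> {1..N}" "k \<in> {1..S n}"
    show "conditional_distribution \<nu> (\<Lambda> n k) (\<lambda>\<omega>. sign_measure (f n k \<omega>))"
      unfolding conditional_distribution_def
    proof (intro conjI ballI)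
      show "AE \<omega> in \<nu>. prob_space (sign_measure (f n k \<omega>)) \<and> sets (sign_measure (f n k \<omega>)) = sets (\<Lambda> n k)"
        using f_range[OF nk] \<Lambda>[OF nk]
        by (intro AE_I2) (simp add: prob_space_sign_measure sets_sign_measure)
      fix D assume "D \<in> sets (\<Lambda> n k)"
      then have "D \<subseteq> {-1, 1}" using \<Lambda>[OF nk] by simp
      \<comment> \<open>Measurability of the kernel on \<open>D\<close> is inherited from
        \<open>f\<close>, because the mass of \<open>D\<close> is affine in
        \<open>f n k \<omega>\<close>.\<close>
      have "(\<lambda>\<omega>. event_offset D + event_slope D * f n k \<omega>) \<in> borel_measurable \<nu>"
        using f_meas[OF nk] by measurable
      then show "(\<lambda>\<omega>. measure (sign_measure (f n k \<omega>)) D) \<in> borel_measurable \<nu>"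
        by (rule measurable_cong[THEN iffD1, rotated])
          (simp add: measure_sign_measure_affine[OF f_range[OF nk] \<open>D \<subseteq> {-1, 1}\<close>])
    qed
  }
  fix s D assume s: "s \<in> setting_tuples N S" and "D \<in> (\<Pi> n\<in>{1..N}. sets (\<Lambda> n (s n)))"
  then have D: "D n \<in> sets (\<Lambda> n (s n))" if "n \<in> {1..N}" for n
    using that by auto
  have s_range: "s n \<in> {1..S n}" if "n \<in> {1..N}" for n
    using s that by (auto simp: setting_tuples_def)
  have \<Lambda>s: "sets (\<Lambda> n (s n)) = sets (count_space {-1, 1})" if "n \<in> {1..N}" for n
    using \<Lambda>[OF that s_range[OF that]] .
  from family s have "prob_space (P s)" and sets_P: "sets (P s) = sets (\<Pi>\<^sub>M n\<in>{1..N}. \<Lambda> n (s n))"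
    by (auto simp: measurement_family_def)
  interpret P: prob_space "P s" by fact
  have x_range: "x n \<in> {-1, 1}" if "x \<in> space (P s)" "n \<in> {1..N}" for x n
    using sign_outcome_cases[OF sets_P \<Lambda>s that] .
  have "measure (P s) (\<Pi>\<^sub>E n\<in>{1..N}. D n) = (\<integral>x. (\<Prod>n=1..N. indicator (D n) (x n)) \<partial>P s)"
    using D by (intro measure_PiE_eq_integral_prod_indicator[OF sets_P] finite_atLeastAtMost)
  also have "\<dots> = (\<integral>x. (\<Prod>n=1..N. event_offset (D n) + event_slope (D n) * x n) \<partial>P s)"
    by (intro Bochner_Integration.integral_cong prod.cong refl indicator_affine x_range)
  also have "\<dots> = (\<integral>\<omega>. (\<Prod>n=1..N. event_offset (D n) + event_slope (D n) * f n (s n) \<omega>) \<partial>\<nu>)"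
  proof (rule integral_prod_affine_cong)
    fix J assume J: "J \<subseteq> {1..N}"
    then have "finite J" by (rule finite_subset) simp
    have "\<bar>x n\<bar> \<le> 1" if "x \<in> space (P s)" "n \<in> J" for x n
      using x_range[OF that(1) subsetD[OF J that(2)]] by auto
    then show "integrable (P s) (\<lambda>x. \<Prod>n\<in>J. x n)"
      using J \<open>finite J\<close> by (intro integrable_prod_AE_bounded P.finite_measure_axioms AE_I2)
        (auto intro!: borel_measurable_sign_outcome[OF sets_P \<Lambda>s])
    have "\<bar>f n (s n) \<omega>\<bar> \<le> 1" if "\<omega> \<in> space \<nu>" "n \<in> J" for \<omega> n
      using f_range[OF _ s_range that(1)] subsetD[OF J that(2)] by (simp add: abs_le_iff minus_le_iff)
    then show "integrable \<nu> (\<lambda>\<omega>. \<Prod>n\<in>J. f n (s n) \<omega>)"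
      using J \<open>finite J\<close> s_range by (intro integrable_prod_AE_bounded \<nu>.finite_measure_axioms AE_I2)
        (auto intro!: f_meas)
    \<comment> \<open>The correlations cover nonempty \<open>J\<close> only; for
      \<open>J = {}\<close> both sides are the total mass 1 of a probability measure.\<close>
    show "(\<integral>x. (\<Prod>n\<in>J. x n) \<partial>P s) = (\<integral>\<omega>. (\<Prod>n\<in>J. f n (s n) \<omega>) \<partial>\<nu>)"
      using corr[OF s J] by (cases "J = {}") (simp_all add: P.prob_space \<nu>.prob_space)
  qed simp
  also have "\<dots> = (\<integral>\<omega>. (\<Prod>n=1..N. measure (sign_measure (f n (s n) \<omega>)) (D n)) \<partial>\<nu>)"
  proof (intro Bochner_Integration.integral_cong prod.cong refl)
    fix \<omega> n assume "\<omega> \<in> space \<nu>" and n: "n \<in> {1..N}"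
    with D[OF n] \<Lambda>s[OF n]
    show "event_offset (D n) + event_slope (D n) * f n (s n) \<omega> = measure (sign_measure (f n (s n) \<omega>)) (D n)"
      by (intro measure_sign_measure_affine[symmetric] f_range s_range) simp_all
  qed
  finally show "measure (P s) (\<Pi>\<^sub>E n\<in>{1..N}. D n)
    = (\<integral>\<omega>. (\<Prod>n=1..N. measure (sign_measure (f n (s n) \<omega>)) (D n)) \<partial>\<nu>)" .
qed

theorem theorem3:
  fixes N :: nat
    and S :: "nat \<Rightarrow> nat"
    and \<Lambda> :: "nat \<Rightarrow> nat \<Rightarrow> real measure"
    and P :: "(nat \<Rightarrow> nat) \<Rightarrow> (nat \<Rightarrow> real) measure"
  assumes "measurement_family N S \<Lambda> P"
    and "(\<Sum>n=1..N. S n) > N"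
    and "\<And>n k. n \<in> {1..N} \<Longrightarrow> k \<in> {1..S n} \<Longrightarrow> sets (\<Lambda> n k) = sets (count_space {-1, 1})"
  shows "admits_LHV_model TYPE('w) N S \<Lambda> P \<longleftrightarrow>
    (\<exists>(\<nu> :: 'w measure) (f :: nat \<Rightarrow> nat \<Rightarrow> 'w \<Rightarrow> real).
       prob_space \<nu> \<and>
       (\<forall>n\<in>{1..N}. \<forall>k\<in>{1..S n}. f n k \<in> \<nu> \<rightarrow>\<^sub>M restrict_space borel {-1..1}) \<and>
       (\<forall>s\<in>setting_tuples N S. \<forall>M\<in>{1..N}. \<forall>n\<in>{1..M} \<rightarrow> {1..N}. strict_mono_on {1..M} n \<longrightarrow>
          (\<integral>x. (\<Prod>i=1..M. x (n i)) \<partial>(P s)) =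
          (\<integral>\<omega>. (\<Prod>i=1..M. f (n i) (s (n i)) \<omega>) \<partial>\<nu>)))"
    (is "_ \<longleftrightarrow> ?R")
proof
  assume "admits_LHV_model TYPE('w) N S \<Lambda> P"
  then obtain \<nu> :: "'w measure" and K where model: "LHV_model N S \<Lambda> P \<nu> K"
    by (auto simp: admits_LHV_model_def)
  \<comment> \<open>A law on \<open>{-1, 1}\<close> with mass p at 1 has mean p - (1 - p) = 2p - 1.
    The range \<open>[-1, 1]\<close> must hold at every point: \<open>min\<close> gives the upper
    bound, nonnegativity of \<open>measure\<close> the lower one.\<close>
  define f where "f n k \<omega> = min 1 (2 * measure (K n k \<omega>) {1} - 1)" for n k \<omega>
  have "f n k \<in> \<nu> \<rightarrow>\<^sub>M restrict_space borel {-1..1}" if nk: "n \<in> {1..N}" "k \<in> {1..S n}" for n k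
  proof (rule measurable_restrict_space2)
    show "f n k \<in> space \<nu> \<rightarrow> {-1..1}" by (simp add: f_def)
    have "(\<lambda>\<omega>. measure (K n k \<omega>) {1}) \<in> borel_measurable \<nu>"
      using model nk assms(3)[OF nk] by (simp add: LHV_model_def conditional_distribution_def)
    then show "f n k \<in> borel_measurable \<nu>"
      unfolding f_def by measurable
  qed
  moreover have "(\<integral>x. (\<Prod>n\<in>J. x n) \<partial>P s) = (\<integral>\<omega>. (\<Prod>n\<in>J. f n (s n) \<omega>) \<partial>\<nu>)"
    if "s \<in> setting_tuples N S" "J \<subseteq> {1..N}" for s J
    unfolding f_def by (rule LHV_model_imp_correlations[OF assms(1,3) model that])
  ultimately show ?R
    \<comment> \<open>Increasing sequences are traded for nonempty subsets of sites. With
      \<open>for f s\<close> the equation stays schematic in both, so it rewrites under their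
      quantifiers.\<close>
    unfolding all_strict_mono_prod_iff[where u = "\<lambda>n x. x n" and v = "\<lambda>n. f n (s n)" for f s]
    using model by (intro exI[of _ \<nu>] exI[of _ f]) (simp add: LHV_model_def)
next
  assume ?R
  then obtain \<nu> :: "'w measure" and f where \<nu>: "prob_space \<nu>"
    and f: "\<And>n k. n \<in> {1..N} \<Longrightarrow> k \<in> {1..S n} \<Longrightarrow> f n k \<in> \<nu> \<rightarrow>\<^sub>M restrict_space borel {-1..1}"
    and corr: "\<forall>s\<in>setting_tuples N S. \<forall>M\<in>{1..N}. \<forall>n\<in>{1..M} \<rightarrow> {1..N}. strict_mono_on {1..M} n \<longrightarrow>
          (\<integral>x. (\<Prod>i=1..M. x (n i)) \<partial>(P s)) = (\<integral>\<omega>. (\<Prod>i=1..M. f (n i) (s (n i)) \<omega>) \<partial>\<nu>)"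
    by blast
  have "LHV_model N S \<Lambda> P \<nu> (\<lambda>n k \<omega>. sign_measure (f n k \<omega>))"
  proof (rule correlations_imp_LHV_model[OF assms(1,3) \<nu> f])
    fix s J assume "s \<in> setting_tuples N S" "J \<subseteq> {1..N}" "J \<noteq> {}"
    then show "(\<integral>x. (\<Prod>n\<in>J. x n) \<partial>P s) = (\<integral>\<omega>. (\<Prod>n\<in>J. f n (s n) \<omega>) \<partial>\<nu>)"
      using corr all_strict_mono_prod_iff[where u = "\<lambda>n x. x n" and v = "\<lambda>n. f n (s n)"] by blast
  qed
  then show "admits_LHV_model TYPE('w) N S \<Lambda> P"
    by (auto simp: admits_LHV_model_def)
qed

end
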